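(* On the set $[\mathbf{Q}]_q=\{[x]_q : x\in\mathbf{Q}\}$ the operations $$[x]_q \oplus_q [y]_q = [x]_q + q^x [y]_q, \qquad [x]_q \otimes_q [y]_q = [x]_q\,[y]_{q^x}\qquad (x,y\in\mathbf{Q})$$ are well-defined, and with these operations $[\mathbf{Q}]_q$ is a field.
   Context: For $x\in\mathbf{Q}$, the quantum rational number is $[x]_q=\frac{1-q^x}{1-q}$, regarded as a function of a real variable $q>0$, $q\ne1$, with the real positive value of $q^x$. For $x=m/n$ with $m\in\mathbf{Z}$ and $n$ a positive integer, it equals $[m]_{q^{1/n}}/[n]_{q^{1/n}}$. The symbol $[y]_{q^x}$ denotes $[y]_q$ with $q$ replaced by $q^x$, that is, $\frac{1-q^{xy}}{1-q^x}$ for $x\neq 0$. For $x=0$, $[y]_1$ is read as $\lim_{q\to1}[y]_q=y$. *)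

theory Defs
  imports Complex_Main "HOL-Library.FuncSet" "HOL-Algebra.Ring"
begin

definition q_domain :: "real set" where
  "q_domain = {q. 0 < q \<and> q \<noteq> 1}"

text \<open>The value of \<open>[x]\<^sub>q\<close>. The case \<open>q = 1\<close> is the limiting value (see \<open>tendsto_q_value\<close>
  below); it lies outside the domain of the quantum rationals and only arises as the
  subscript \<open>q\<^sup>x\<close> with \<open>x = 0\<close>.\<close>
definition q_value :: "rat \<Rightarrow> real \<Rightarrow> real" where
  "q_value x q = (if q = 1 then of_rat x else (1 - q powr of_rat x) / (1 - q))"

definition qrat :: "rat \<Rightarrow> real \<Rightarrow> real" where
  "qrat x = (\<lambda>q\<in>q_domain. q_value x q)"

definition qrat_set :: "(real \<Rightarrow> real) set" where
  "qrat_set = range qrat"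

text \<open>The right-hand sides defining the two operations, as functions of \<open>q\<close> depending on the
  representatives \<open>x\<close> and \<open>y\<close>; a priori neither independent of these representatives nor
  again quantum rationals.\<close>
definition q_sum :: "rat \<Rightarrow> rat \<Rightarrow> real \<Rightarrow> real" where
  "q_sum x y = (\<lambda>q\<in>q_domain. qrat x q + q powr of_rat x * qrat y q)"

definition q_prod :: "rat \<Rightarrow> rat \<Rightarrow> real \<Rightarrow> real" where
  "q_prod x y = (\<lambda>q\<in>q_domain. qrat x q * q_value y (q powr of_rat x))"

text \<open>The descriptions below denote the intended values only if the operations are independent
  of the representatives, so this has to be asserted separately.\<close>
definition qrat_add :: "(real \<Rightarrow> real) \<Rightarrow> (real \<Rightarrow> real) \<Rightarrow> real \<Rightarrow> real" where
  "qrat_add f g = (THE h. \<exists>x y. f = qrat x \<and> g = qrat y \<and> h = q_sum x y)"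

definition qrat_mult :: "(real \<Rightarrow> real) \<Rightarrow> (real \<Rightarrow> real) \<Rightarrow> real \<Rightarrow> real" where
  "qrat_mult f g = (THE h. \<exists>x y. f = qrat x \<and> g = qrat y \<and> h = q_prod x y)"

definition qrat_ring :: "(real \<Rightarrow> real) ring" where
  "qrat_ring = \<lparr>carrier = qrat_set, mult = qrat_mult, one = qrat 1,
                zero = qrat 0, add = qrat_add\<rparr>"

lemma tendsto_q_value: "((\<lambda>q. q_value y q) \<longlongrightarrow> q_value y 1) (at 1)"
proof -
  have "((\<lambda>q::real. q powr of_rat y) has_real_derivative of_rat y) (at 1)"
    by (auto intro!: derivative_eq_intros)
  then have "((\<lambda>q. (q powr of_rat y - 1) / (q - 1)) \<longlongrightarrow> of_rat y) (at (1::real))"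
    by (simp add: has_field_derivative_iff LIM_offset_zero_iff add.commute)
  moreover have "\<forall>\<^sub>F q in at (1::real). (q powr of_rat y - 1) / (q - 1) = q_value y q"
    by (auto simp: eventually_at_filter q_value_def divide_simps algebra_simps)
  ultimately show ?thesis
    by (simp add: q_value_def tendsto_cong)
qed

lemma q_value_powr:
  assumes "q \<in> q_domain" "x \<noteq> 0"
  shows "q_value y (q powr of_rat x) = (1 - q powr of_rat (x * y)) / (1 - q powr of_rat x)"
  using assms by (auto simp: q_value_def q_domain_def powr_powr of_rat_mult powr_eq_one_iff_gen)

lemma qrat_fraction:
  fixes m :: int and n :: int
  assumes "q \<in> q_domain" "n > 0"
  shows "qrat (of_int m / of_int n) q =
    q_value (of_int m) (q powr (1 / of_int n)) / q_value (of_int n) (q powr (1 / of_int n))"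
  using assms
  by (auto simp: qrat_def q_value_def q_domain_def powr_powr of_rat_divide powr_eq_one_iff_gen)

end

theory Submission
  imports Defs
begin

text \<open>The map \<open>x \<mapsto> [x]\<^sub>q\<close> is injective on the rationals: already the value at \<open>q = 2\<close>
  determines \<open>x\<close>, because \<open>2\<^sup>x\<close> does. Hence any operation on representatives is well-defined,
  and the only question is what the two operations are. Writing \<open>[x]\<^sub>q = (1 - q\<^sup>x) / (1 - q)\<close>,
  both right-hand sides telescope:
  \<open>(1 - q\<^sup>x) + q\<^sup>x (1 - q\<^sup>y) = 1 - q\<^sup>x\<^sup>+\<^sup>y\<close>, and in the product the numerator \<open>1 - q\<^sup>x\<close> of the
  first factor cancels the denominator of the second, leaving \<open>(1 - q\<^sup>x\<^sup>y) / (1 - q)\<close>. So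
  \<open>[x]\<^sub>q \<oplus> [y]\<^sub>q = [x + y]\<^sub>q\<close> and \<open>[x]\<^sub>q \<otimes> [y]\<^sub>q = [x y]\<^sub>q\<close> (\<open>q_sum_eq\<close>, \<open>q_prod_eq\<close>): the
  structure is the field of rationals transported along a bijection.\<close>

lemma qrat_inj: "qrat x = qrat y \<longleftrightarrow> x = y"
proof
  assume "qrat x = qrat y"
  then have "qrat x 2 = qrat y 2" by simp
  then have "(2::real) powr of_rat x = 2 powr of_rat y"
    by (simp add: qrat_def q_value_def q_domain_def)
  then show "x = y" by (simp add: powr_inj)
qed simp

lemma q_sum_eq: "q_sum x y = qrat (x + y)"
proof
  fix q :: real
  show "q_sum x y q = qrat (x + y) q"
    by (auto simp: q_sum_def qrat_def q_value_def q_domain_def of_rat_add powr_add field_simps)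
qed

text \<open>For \<open>x = 0\<close> there is nothing to cancel: the second factor is the limiting value \<open>y\<close>,
  and the first factor \<open>[0]\<^sub>q = 0\<close> annihilates it.\<close>
lemma q_prod_eq: "q_prod x y = qrat (x * y)"
proof
  fix q :: real
  show "q_prod x y q = qrat (x * y) q"
  proof (cases "q \<in> q_domain \<and> x \<noteq> 0")
    case True
    then have "q powr of_rat x \<noteq> 1"
      by (auto simp: q_domain_def powr_eq_one_iff_gen)
    with True show ?thesis
      by (auto simp: q_prod_def q_value_powr) (auto simp: qrat_def q_value_def q_domain_def)
  qed (auto simp: q_prod_def qrat_def q_value_def q_domain_def)
qed

lemma qrat_add_eq: "qrat_add (qrat x) (qrat y) = qrat (x + y)"
  by (auto simp: qrat_add_def qrat_inj q_sum_eq)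

lemma qrat_mult_eq: "qrat_mult (qrat x) (qrat y) = qrat (x * y)"
  by (auto simp: qrat_mult_def qrat_inj q_prod_eq)

lemma field_qrat_ring: "field qrat_ring"
proof -
  note transport = qrat_ring_def qrat_set_def qrat_add_eq qrat_mult_eq qrat_inj
  have "abelian_group qrat_ring"
  proof (rule abelian_groupI)
    fix f assume "f \<in> carrier qrat_ring"
    then obtain x where "f = qrat x" by (auto simp: transport)
    then show "\<exists>g\<in>carrier qrat_ring. g \<oplus>\<^bsub>qrat_ring\<^esub> f = \<zero>\<^bsub>qrat_ring\<^esub>"
      by (auto simp: transport intro: exI[of _ "- x"])
  qed (auto simp: transport add_ac)
  moreover have "comm_monoid qrat_ring"
    by (rule comm_monoidI) (auto simp: transport mult_ac)
  ultimately have "cring qrat_ring"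
    by (rule cringI) (auto simp: transport distrib_right)
  moreover have "Units qrat_ring = carrier qrat_ring - {\<zero>\<^bsub>qrat_ring\<^esub>}"
  proof -
    have "qrat x \<in> Units qrat_ring \<longleftrightarrow> x \<noteq> 0" for x
      by (auto simp: Units_def transport intro: exI[of _ "inverse x"])
    moreover have "Units qrat_ring \<subseteq> range qrat" "carrier qrat_ring = range qrat"
      by (auto simp: Units_def transport)
    moreover have "\<zero>\<^bsub>qrat_ring\<^esub> = qrat 0" by (simp add: transport)
    ultimately show ?thesis by (auto simp: qrat_inj)
  qed
  ultimately show ?thesis by (rule cring.cring_fieldI)
qed

theorem mainTheorem3:
  shows "(\<forall>x x' y y'. qrat x = qrat x' \<longrightarrow> qrat y = qrat y' \<longrightarrow>
            q_sum x y = q_sum x' y' \<and> q_prod x y = q_prod x' y')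
    \<and> (\<forall>x y. q_sum x y \<in> qrat_set \<and> q_prod x y \<in> qrat_set)
    \<and> (\<forall>x y. qrat x \<oplus>\<^bsub>qrat_ring\<^esub> qrat y = q_sum x y
            \<and> qrat x \<otimes>\<^bsub>qrat_ring\<^esub> qrat y = q_prod x y)
    \<and> field qrat_ring"
  using field_qrat_ring
  by (auto simp: qrat_inj q_sum_eq q_prod_eq qrat_set_def qrat_ring_def qrat_add_eq qrat_mult_eq)

end
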